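(* Let $K=\mathbb{Q}(\tau)$ with $\tau^2=-3$, and let $X_K=\{x_0^4-x_0x_1^3-x_2^4+x_2x_3^3=0\}\subset\mathbb{P}^3_K$. The $24$ lines $L_1,\dots,L_{24}$ listed in the context are pairwise distinct and lie on $X_K$.
   Context: For $a,b,c,d\in K$ let $L(a,b;c,d)$ be the projective line spanned by $(1,0,a,b)$ and $(0,1,c,d)$, i.e. the image of $[s:t]\mapsto[s:t:as+ct:bs+dt]$. The lines $L_j=L(a,b;c,d)$ are: - $L_1=L(1,0;0,1)$ - $L_2=L(-1,0;0,-1)$ - $L_3=L(-1,0;0,(1-\tau)/2)$ - $L_4=L(-1,0;0,(1+\tau)/2)$ - $L_5=L(1,0;0,-(1+\tau)/2)$ - $L_6=L(1,0;0,(-1+\tau)/2)$ - $L_7=L(-\tau/3,-1-\tau/3;(-3-\tau)/6,(3-\tau)/6)$ - $L_8=L(-\tau/3,2\tau/3;(3-\tau)/6,(3-\tau)/6)$ - $L_9=L(-\tau/3,1-\tau/3;\tau/3,(3-\tau)/6)$ - $L_{10}=L(\tau/3,-1+\tau/3;(-3+\tau)/6,(3+\tau)/6)$ - $L_{11}=L(\tau/3,-2\tau/3;(3+\tau)/6,(3+\tau)/6)$ - $L_{12}=L(\tau/3,1+\tau/3;-\tau/3,(3+\tau)/6)$ - $L_{13}=L(\tau/3,-1+\tau/3;(3+\tau)/6,-\tau/3)$ - $L_{14}=L(\tau/3,-2\tau/3;-\tau/3,-\tau/3)$ - $L_{15}=L(\tau/3,1+\tau/3;(-3+\tau)/6,-\tau/3)$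 - $L_{16}=L(-\tau/3,-1-\tau/3;(3-\tau)/6,\tau/3)$ - $L_{17}=L(-\tau/3,2\tau/3;\tau/3,\tau/3)$ - $L_{18}=L(-\tau/3,1-\tau/3;(-3-\tau)/6,\tau/3)$ - $L_{19}=L(-\tau/3,-1-\tau/3;\tau/3,(-3-\tau)/6)$ - $L_{20}=L(-\tau/3,2\tau/3;(-3-\tau)/6,(-3-\tau)/6)$ - $L_{21}=L(-\tau/3,1-\tau/3;(3-\tau)/6,(-3-\tau)/6)$ - $L_{22}=L(\tau/3,-1+\tau/3;-\tau/3,(-3+\tau)/6)$ - $L_{23}=L(\tau/3,-2\tau/3;(-3+\tau)/6,(-3+\tau)/6)$ - $L_{24}=L(\tau/3,1+\tau/3;(3+\tau)/6,(-3+\tau)/6)$ *)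

theory Defs
  imports "HOL-Analysis.Cartesian_Space"
begin

definition is_subfield :: "'k::field set \<Rightarrow> bool" where
  "is_subfield S \<longleftrightarrow> 0 \<in> S \<and> 1 \<in> S \<and>
     (\<forall>x\<in>S. \<forall>y\<in>S. x + y \<in> S \<and> x * y \<in> S) \<and>
     (\<forall>x\<in>S. - x \<in> S \<and> inverse x \<in> S)"

(* The subfield Q(t) of a field of characteristic 0. The rationals need not be
   mentioned, since every subfield contains the prime field. *)
definition rat_adjoin :: "'k::field_char_0 \<Rightarrow> 'k set" where
  "rat_adjoin t = \<Inter>{S. is_subfield S \<and> t \<in> S}"

definition proportional :: "'k::field ^ 'n \<Rightarrow> 'k ^ 'n \<Rightarrow> bool" where
  "proportional v w \<longleftrightarrow> v \<noteq> 0 \<and> w \<noteq> 0 \<and> (\<exists>c. c \<noteq> 0 \<and> w = c *s v)"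

lemma part_equivp_proportional: "part_equivp (proportional :: 'k::field ^ 'n \<Rightarrow> _)"
proof (rule part_equivpI)
  have "(1 :: 'k ^ 'n) \<noteq> 0"
    by (simp add: vec_eq_iff)
  moreover have "(1 :: 'k ^ 'n) = 1 *s 1"
    by (simp add: vec_eq_iff)
  ultimately show "\<exists>x :: 'k ^ 'n. proportional x x"
    unfolding proportional_def by (metis one_neq_zero)
  show "symp (proportional :: 'k ^ 'n \<Rightarrow> _)"
  proof (rule sympI)
    fix v w :: "'k ^ 'n"
    assume "proportional v w"
    then obtain c where c: "v \<noteq> 0" "w \<noteq> 0" "c \<noteq> 0" "w = c *s v"
      unfolding proportional_def by blast
    then have "v = inverse c *s w"
      by (simp add: vec_eq_iff)
    with c show "proportional w v"
      unfolding proportional_def by (metis inverse_nonzero_iff_nonzero)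
  qed
  show "transp (proportional :: 'k ^ 'n \<Rightarrow> _)"
  proof (rule transpI)
    fix u v w :: "'k ^ 'n"
    assume "proportional u v" "proportional v w"
    then obtain c d where "u \<noteq> 0" "w \<noteq> 0" "c \<noteq> 0" "v = c *s u" "d \<noteq> 0" "w = d *s v"
      unfolding proportional_def by blast
    then have "w = (d * c) *s u" "d * c \<noteq> 0"
      by (simp_all add: vec_eq_iff mult.assoc)
    with \<open>u \<noteq> 0\<close> \<open>w \<noteq> 0\<close> show "proportional u w"
      unfolding proportional_def by blast
  qed
qed

(* The projective space of lines through the origin of k^n, whose projective
   dimension is CARD('n) - 1: (k, 2) proj is the projective line and (k, 4) proj is
   projective 3-space. The relation is partial because the zero vector is excluded. *)
quotient_type (overloaded) ('k, 'n) proj = "'k::field ^ 'n::finite" / partial: proportional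
  by (rule part_equivp_proportional)

lemma vector_4:
  "(vector [x, y, z, w] :: 'a::zero ^ 4) $ 1 = x"
  "(vector [x, y, z, w] :: 'a::zero ^ 4) $ 2 = y"
  "(vector [x, y, z, w] :: 'a::zero ^ 4) $ 3 = z"
  "(vector [x, y, z, w] :: 'a::zero ^ 4) $ 4 = w"
  unfolding vector_def by simp_all

(* The map [s : t] \<mapsto> [s : t : a s + c t : b s + d t]. Vector components are numbered
   from 1, so the homogeneous coordinates x0, ..., x3 are x $ 1, ..., x $ 4. *)
lift_definition line_map :: "'k::field \<Rightarrow> 'k \<Rightarrow> 'k \<Rightarrow> 'k \<Rightarrow> ('k, 2) proj \<Rightarrow> ('k, 4) proj"
  is "\<lambda>a b c d v. vector [v $ 1, v $ 2, a * v $ 1 + c * v $ 2, b * v $ 1 + d * v $ 2]"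
proof -
  fix a b c d :: 'k and v w :: "'k ^ 2"
  let ?f = "\<lambda>v :: 'k ^ 2. vector [v $ 1, v $ 2, a * v $ 1 + c * v $ 2, b * v $ 1 + d * v $ 2] :: 'k ^ 4"
  have nonzero: "?f u \<noteq> 0" if "u \<noteq> 0" for u :: "'k ^ 2"
    using that by (auto simp: vec_eq_iff forall_2 forall_4 vector_4)
  assume "proportional v w"
  then obtain e where e: "v \<noteq> 0" "w \<noteq> 0" "e \<noteq> 0" "w = e *s v"
    unfolding proportional_def by blast
  have "?f w = e *s ?f v"
    unfolding e(4) by (simp add: vec_eq_iff forall_4 vector_4 algebra_simps)
  with e nonzero show "proportional (?f v) (?f w)"
    unfolding proportional_def by blast
qed

definition proj_line :: "'k::field \<Rightarrow> 'k \<Rightarrow> 'k \<Rightarrow> 'k \<Rightarrow> ('k, 4) proj set" where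
  "proj_line a b c d = range (line_map a b c d)"

lift_definition on_quartic :: "('k::field, 4) proj \<Rightarrow> bool"
  is "\<lambda>x. x $ 1 ^ 4 - x $ 1 * x $ 2 ^ 3 - x $ 3 ^ 4 + x $ 3 * x $ 4 ^ 3 = 0"
proof -
  fix x y :: "'k ^ 4"
  assume "proportional x y"
  then obtain c where c: "c \<noteq> 0" "y = c *s x"
    unfolding proportional_def by blast
  have "y $ 1 ^ 4 - y $ 1 * y $ 2 ^ 3 - y $ 3 ^ 4 + y $ 3 * y $ 4 ^ 3
      = c ^ 4 * (x $ 1 ^ 4 - x $ 1 * x $ 2 ^ 3 - x $ 3 ^ 4 + x $ 3 * x $ 4 ^ 3)"
    unfolding c(2) by (simp add: power_mult_distrib algebra_simps eval_nat_numeral)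
  with c(1) show "(x $ 1 ^ 4 - x $ 1 * x $ 2 ^ 3 - x $ 3 ^ 4 + x $ 3 * x $ 4 ^ 3 = 0)
      = (y $ 1 ^ 4 - y $ 1 * y $ 2 ^ 3 - y $ 3 ^ 4 + y $ 3 * y $ 4 ^ 3 = 0)"
    by simp
qed

definition quartic_surface :: "('k::field, 4) proj set" where
  "quartic_surface = {P. on_quartic P}"

definition lines_list :: "'k::field \<Rightarrow> ('k, 4) proj set list" where
  "lines_list \<tau> =
    [proj_line 1 0 0 1,
     proj_line (-1) 0 0 (-1),
     proj_line (-1) 0 0 ((1 - \<tau>) / 2),
     proj_line (-1) 0 0 ((1 + \<tau>) / 2),
     proj_line 1 0 0 (- (1 + \<tau>) / 2),
     proj_line 1 0 0 ((-1 + \<tau>) / 2),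
     proj_line (- \<tau> / 3) (-1 - \<tau> / 3) ((-3 - \<tau>) / 6) ((3 - \<tau>) / 6),
     proj_line (- \<tau> / 3) (2 * \<tau> / 3) ((3 - \<tau>) / 6) ((3 - \<tau>) / 6),
     proj_line (- \<tau> / 3) (1 - \<tau> / 3) (\<tau> / 3) ((3 - \<tau>) / 6),
     proj_line (\<tau> / 3) (-1 + \<tau> / 3) ((-3 + \<tau>) / 6) ((3 + \<tau>) / 6),
     proj_line (\<tau> / 3) (-2 * \<tau> / 3) ((3 + \<tau>) / 6) ((3 + \<tau>) / 6),
     proj_line (\<tau> / 3) (1 + \<tau> / 3) (- \<tau> / 3) ((3 + \<tau>) / 6),
     proj_line (\<tau> / 3) (-1 + \<tau> / 3) ((3 + \<tau>) / 6) (- \<tau> / 3),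
     proj_line (\<tau> / 3) (-2 * \<tau> / 3) (- \<tau> / 3) (- \<tau> / 3),
     proj_line (\<tau> / 3) (1 + \<tau> / 3) ((-3 + \<tau>) / 6) (- \<tau> / 3),
     proj_line (- \<tau> / 3) (-1 - \<tau> / 3) ((3 - \<tau>) / 6) (\<tau> / 3),
     proj_line (- \<tau> / 3) (2 * \<tau> / 3) (\<tau> / 3) (\<tau> / 3),
     proj_line (- \<tau> / 3) (1 - \<tau> / 3) ((-3 - \<tau>) / 6) (\<tau> / 3),
     proj_line (- \<tau> / 3) (-1 - \<tau> / 3) (\<tau> / 3) ((-3 - \<tau>) / 6),
     proj_line (- \<tau> / 3) (2 * \<tau> / 3) ((-3 - \<tau>) / 6) ((-3 - \<tau>) / 6),
     proj_line (- \<tau> / 3) (1 - \<tau> / 3) ((3 - \<tau>) / 6) ((-3 - \<tau>) / 6),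
     proj_line (\<tau> / 3) (-1 + \<tau> / 3) (- \<tau> / 3) ((-3 + \<tau>) / 6),
     proj_line (\<tau> / 3) (-2 * \<tau> / 3) ((-3 + \<tau>) / 6) ((-3 + \<tau>) / 6),
     proj_line (\<tau> / 3) (1 + \<tau> / 3) ((3 + \<tau>) / 6) ((-3 + \<tau>) / 6)]"

definition L :: "'k::field \<Rightarrow> nat \<Rightarrow> ('k, 4) proj set" where
  "L \<tau> j = lines_list \<tau> ! (j - 1)"

end

theory Submission
  imports Defs
begin

text \<open>
  Write \<open>f(x, y) = x\<^sup>4 - x y\<^sup>3\<close>, so that the quartic is \<open>f(x\<^sub>0, x\<^sub>1) = f(x\<^sub>2, x\<^sub>3)\<close>. The line
  \<open>L(a, b; c, d)\<close> is the graph of the linear substitution \<open>(s, t) \<mapsto> (a s + c t, b s + d t)\<close>,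
  and it lies on the quartic as soon as this substitution leaves \<open>f\<close> invariant
  (\<open>proj_line_subset_quartic\<close>). The graph determines the substitution (\<open>proj_line_eq_iff\<close>).

  Let \<open>\<omega> = (\<tau> - 1) / 2\<close>, a primitive cube root of unity. The form \<open>f\<close> is invariant under
  \<open>-1\<close>, under \<open>D: (s, t) \<mapsto> (s, \<omega> t)\<close> and, because the four roots of \<open>f\<close> form an equianharmonic
  set, under the further substitution \<open>V: (s, t) \<mapsto> (\<tau>/3 (s - t), -\<tau>/3 (2 s + t))\<close>, which
  exchanges the root \<open>s = 0\<close> with the root \<open>s = t\<close>. The 24 lines are the graphs of the 6
  substitutions \<open>\<plusminus>D\<^sup>i\<close> and of the 18 substitutions \<open>\<plusminus>D\<^sup>i V D\<^sup>j\<close>, with \<open>i, j < 3\<close>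
  (\<open>lines_list_eq\<close>). Their coefficients show that they are different: whether the coefficient
  \<open>b\<close> vanishes tells the two families apart, \<open>a\<close> gives the sign, and the
  remaining coefficients give the powers of \<open>\<omega>\<close>.
\<close>

section \<open>Lines as graphs of binary substitutions\<close>

lemma line_map_parameter:
  "line_map a b c d P = line_map a' b' c' d' Q \<Longrightarrow> P = Q"
proof (transfer, goal_cases)
  case (1 a b c d v a' b' c' d' w)
  then obtain k where "k \<noteq> 0" "w $ 1 = k * v $ 1" "w $ 2 = k * v $ 2"
    unfolding proportional_def by (force simp: vec_eq_iff forall_4 vector_4)
  then have "k \<noteq> 0" "w = k *s v"
    by (simp_all add: vec_eq_iff forall_2)
  with 1 show ?case
    unfolding proportional_def by blast
qed

lemma line_map_coefficients:
  assumes "\<forall>P. line_map a b c d P = line_map a' b' c' d' P"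
  shows "(a, b, c, d) = (a', b', c', d')"
proof -
  let ?f = "\<lambda>a b c d (v :: 'a ^ 2).
    vector [v $ 1, v $ 2, a * v $ 1 + c * v $ 2, b * v $ 1 + d * v $ 2] :: 'a ^ 4"
  have same: "proportional (?f a b c d v) (?f a' b' c' d' v)" if "v \<noteq> 0" for v
  proof -
    have "proportional v v"
      using that unfolding proportional_def by (metis one_neq_zero vector_smult_lid)
    then show ?thesis
      using assms by transfer blast
  qed
  have "vector [1, 0] \<noteq> (0 :: 'a ^ 2)" "vector [0, 1] \<noteq> (0 :: 'a ^ 2)"
    by (auto simp: vec_eq_iff forall_2)
  from this[THEN same] show ?thesis
    by (auto simp: proportional_def vec_eq_iff forall_2 forall_4 vector_4)
qed

text \<open>
  The first two coordinates of a point of the line are its parameters, so two lines that agree as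
  sets have the same parametrization; its values at \<open>[1 : 0]\<close> and \<open>[0 : 1]\<close> are the coefficients.
\<close>

lemma proj_line_eq_iff:
  "proj_line a b c d = proj_line a' b' c' d' \<longleftrightarrow> (a, b, c, d) = (a', b', c', d')"
proof
  assume eq: "proj_line a b c d = proj_line a' b' c' d'"
  have "line_map a b c d P = line_map a' b' c' d' P" for P
  proof -
    obtain Q where "line_map a b c d P = line_map a' b' c' d' Q"
      using eq unfolding proj_line_def by blast
    then show ?thesis
      using line_map_parameter by metis
  qed
  then show "(a, b, c, d) = (a', b', c', d')"
    by (intro line_map_coefficients) blast
qed simp

definition quartic_form :: "'k::comm_ring_1 \<Rightarrow> 'k \<Rightarrow> 'k" where
  "quartic_form x y = x ^ 4 - x * y ^ 3"

lemma proj_line_subset_quartic: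
  assumes "\<And>s t. quartic_form (a * s + c * t) (b * s + d * t) = quartic_form s t"
  shows "proj_line a b c d \<subseteq> quartic_surface"
proof -
  have "\<forall>s t. s ^ 4 - s * t ^ 3 - (a * s + c * t) ^ 4 + (a * s + c * t) * (b * s + d * t) ^ 3 = 0"
    using assms by (simp add: quartic_form_def algebra_simps)
  then have "on_quartic (line_map a b c d P)" for P
    by transfer (simp add: vector_4)
  then show ?thesis
    unfolding proj_line_def quartic_surface_def by blast
qed

section \<open>Invariance of the quartic form\<close>

locale sqrt_minus_three =
  fixes \<tau> :: "'k::field_char_0"
  assumes square: "\<tau> ^ 2 = -3"
begin

definition \<omega> :: 'k where "\<omega> = (\<tau> - 1) / 2"

lemma omega_square: "\<omega>\<^sup>2 = - (\<tau> + 1) / 2"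
  using square by (simp add: \<omega>_def field_simps power2_eq_square)

lemma omega_cube: "\<omega> ^ 3 = 1"
proof -
  have "\<omega> ^ 3 = \<omega> * \<omega>\<^sup>2"
    by (simp add: eval_nat_numeral)
  also have "\<dots> = 1"
    unfolding omega_square using square by (simp add: \<omega>_def field_simps power2_eq_square)
  finally show ?thesis .
qed

lemma tau_neq: "\<tau> \<noteq> 0" "\<tau> \<noteq> of_int n"
proof -
  show "\<tau> \<noteq> of_int n"
  proof
    assume "\<tau> = of_int n"
    then have "(of_int (n ^ 2) :: 'k) = of_int (-3)"
      using square by simp
    then have "n ^ 2 = -3"
      by (simp only: of_int_eq_iff)
    then show False
      using zero_le_power2[of n] by linarith
  qed
qed (use square in auto)

lemma omega_power_eq_iff:
  assumes "i < 3" "j < 3"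
  shows "\<omega> ^ i = \<omega> ^ j \<longleftrightarrow> i = j"
proof -
  have "\<omega> \<noteq> 1" "\<omega>\<^sup>2 \<noteq> 1" "\<omega>\<^sup>2 \<noteq> \<omega>"
    unfolding omega_square using tau_neq(2)[of 3] tau_neq(2)[of "-3"] tau_neq(1)
    by (auto simp: \<omega>_def field_simps eq_neg_iff_add_eq_0)
  moreover have "i \<in> {0, 1, 2}" "j \<in> {0, 1, 2}"
    using assms by auto
  ultimately show ?thesis
    by auto
qed

lemma omega_power_cube: "(\<omega> ^ i) ^ 3 = 1"
  by (metis omega_cube power_mult mult.commute power_one)

lemma quartic_form_scale: "quartic_form x (\<omega> ^ i * y) = quartic_form x y"
  by (simp add: quartic_form_def power_mult_distrib omega_power_cube)

lemma quartic_form_sign: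
  assumes "\<epsilon> \<in> {1, -1}"
  shows "quartic_form (\<epsilon> * x) (\<epsilon> * y) = quartic_form x (y :: 'k)"
  using assms by (auto simp: quartic_form_def)

text \<open>
  With \<open>u = s - t\<close> and \<open>v = -(2 s + t)\<close> the difference \<open>u\<^sup>3 - v\<^sup>3\<close> has the factor
  \<open>u - v = 3 s\<close>, and the cofactor is \<open>3 (s\<^sup>2 + s t + t\<^sup>2)\<close>. So \<open>f(u, v) = 9 f(s, t)\<close>, as
  \<open>(s - t) (s\<^sup>2 + s t + t\<^sup>2) = s\<^sup>3 - t\<^sup>3\<close>, and the
  factor \<open>9\<close> is cancelled by \<open>(\<tau>/3)\<^sup>4 = 1/9\<close>.
\<close>

lemma quartic_form_exchange:
  "quartic_form (\<tau> / 3 * (s - t)) (\<tau> / 3 * - (2 * s + t)) = quartic_form s t"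
proof -
  have homogeneous: "quartic_form (k * x) (k * y) = k ^ 4 * quartic_form x y" for k x y :: 'k
    by (simp add: quartic_form_def power_mult_distrib algebra_simps eval_nat_numeral)
  have "(\<tau> / 3) ^ 4 = ((\<tau> ^ 2) ^ 2) / 81"
    by (simp add: power_divide flip: power_mult)
  then have "(\<tau> / 3) ^ 4 = 1 / 9"
    by (simp add: square)
  moreover have "quartic_form (s - t) (- (2 * s + t)) = 9 * quartic_form s t"
    unfolding quartic_form_def by algebra
  ultimately show ?thesis
    unfolding homogeneous by simp
qed

section \<open>The lines as two families of graphs\<close>

text \<open>The graphs of \<open>\<epsilon> D\<^sup>i\<close> and of \<open>\<epsilon> D\<^sup>i V D\<^sup>j\<close>, where \<open>\<epsilon> = \<plusminus>1\<close>.\<close>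

fun diagonal_line :: "'k \<times> nat \<Rightarrow> ('k, 4) proj set" where
  "diagonal_line (\<epsilon>, i) = proj_line \<epsilon> 0 0 (\<epsilon> * \<omega> ^ i)"

fun exchange_line :: "'k \<times> nat \<times> nat \<Rightarrow> ('k, 4) proj set" where
  "exchange_line (\<epsilon>, i, j) =
     proj_line (\<epsilon> * (\<tau> / 3)) (\<epsilon> * (-2 * \<tau> / 3) * \<omega> ^ i)
       (\<epsilon> * (- \<tau> / 3) * \<omega> ^ j) (\<epsilon> * (- \<tau> / 3) * \<omega> ^ i * \<omega> ^ j)"

lemma diagonal_line_subset:
  assumes "\<epsilon> \<in> {1, -1}"
  shows "diagonal_line (\<epsilon>, i) \<subseteq> quartic_surface"
  unfolding diagonal_line.simps
proof (rule proj_line_subset_quartic)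
  fix s t
  show "quartic_form (\<epsilon> * s + 0 * t) (0 * s + \<epsilon> * \<omega> ^ i * t) = quartic_form s t"
    using quartic_form_sign[OF assms] quartic_form_scale by (simp add: mult.assoc)
qed

lemma exchange_line_subset:
  assumes "\<epsilon> \<in> {1, -1}"
  shows "exchange_line (\<epsilon>, i, j) \<subseteq> quartic_surface"
  unfolding exchange_line.simps
proof (rule proj_line_subset_quartic)
  fix s t
  let ?t = "\<omega> ^ j * t"
  have "\<epsilon> * (\<tau> / 3) * s + \<epsilon> * (- \<tau> / 3) * \<omega> ^ j * t = \<epsilon> * (\<tau> / 3 * (s - ?t))"
    and "\<epsilon> * (-2 * \<tau> / 3) * \<omega> ^ i * s + \<epsilon> * (- \<tau> / 3) * \<omega> ^ i * \<omega> ^ j * t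
      = \<epsilon> * (\<omega> ^ i * (\<tau> / 3 * - (2 * s + ?t)))"
    by (simp_all add: field_simps)
  then show "quartic_form (\<epsilon> * (\<tau> / 3) * s + \<epsilon> * (- \<tau> / 3) * \<omega> ^ j * t)
      (\<epsilon> * (-2 * \<tau> / 3) * \<omega> ^ i * s + \<epsilon> * (- \<tau> / 3) * \<omega> ^ i * \<omega> ^ j * t)
    = quartic_form s t"
    by (simp only: quartic_form_sign[OF assms] quartic_form_scale quartic_form_exchange)
qed

lemma inj_on_diagonal_line: "inj_on diagonal_line ({1, -1} \<times> {..<3})"
  by (auto simp: inj_on_def proj_line_eq_iff omega_power_eq_iff)

lemma inj_on_exchange_line: "inj_on exchange_line ({1, -1} \<times> {..<3} \<times> {..<3})"
  using tau_neq(1) by (auto simp: inj_on_def proj_line_eq_iff omega_power_eq_iff)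

lemma diagonal_line_neq_exchange_line:
  assumes "\<delta> \<in> {1, -1}"
  shows "diagonal_line (\<epsilon>, i) \<noteq> exchange_line (\<delta>, j, k)"
proof -
  have "\<omega> \<noteq> 0"
    using omega_cube by auto
  then show ?thesis
    using assms tau_neq(1) by (auto simp: proj_line_eq_iff)
qed

text \<open>The order of the parameters is that of the list of lines.\<close>

definition diagonal_parameters :: "('k \<times> nat) list" where
  "diagonal_parameters = [(1, 0), (-1, 0), (-1, 1), (-1, 2), (1, 2), (1, 1)]"

definition exchange_parameters :: "('k \<times> nat \<times> nat) list" where
  "exchange_parameters =
    [(-1, 1, 1), (-1, 0, 2), (-1, 2, 0), (1, 2, 2), (1, 0, 1), (1, 1, 0),
     (1, 2, 1), (1, 0, 0), (1, 1, 2), (-1, 1, 2), (-1, 0, 0), (-1, 2, 1),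
     (-1, 1, 0), (-1, 0, 1), (-1, 2, 2), (1, 2, 0), (1, 0, 2), (1, 1, 1)]"

lemma set_parameters:
  "set diagonal_parameters \<subseteq> {1, -1} \<times> {..<3}"
  "set exchange_parameters \<subseteq> {1, -1} \<times> {..<3} \<times> {..<3}"
  by (auto simp: diagonal_parameters_def exchange_parameters_def)

text \<open>
  The tabulated coefficients arise from \<open>\<omega> \<tau> = -(3 + \<tau>)/2\<close> and \<open>\<omega>\<^sup>2 \<tau> = (3 - \<tau>)/2\<close>: the
  sign is read off from \<open>a\<close>, the exponent of the left factor \<open>D\<^sup>i\<close> from \<open>b\<close>, or from \<open>d\<close> on the
  diagonal, and the exponent of the right factor \<open>D\<^sup>j\<close> from \<open>c\<close>.
\<close>

lemma lines_list_eq: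
  "lines_list \<tau> = map diagonal_line diagonal_parameters @ map exchange_line exchange_parameters"
proof -
  have reduce: "\<tau> * \<tau> = -3" "\<tau> * (\<tau> * x) = -3 * x" for x
    using square by (simp_all add: power2_eq_square flip: mult.assoc)
  show ?thesis
    unfolding lines_list_def diagonal_parameters_def exchange_parameters_def
    by (simp add: proj_line_eq_iff omega_square)
     (simp add: \<omega>_def field_simps reduce)
qed

lemma distinct_lines_list: "distinct (lines_list \<tau>)"
proof -
  have "distinct diagonal_parameters" "distinct exchange_parameters"
    by (simp_all add: diagonal_parameters_def exchange_parameters_def)
  moreover have "inj_on diagonal_line (set diagonal_parameters)"
    "inj_on exchange_line (set exchange_parameters)"
    using inj_on_diagonal_line inj_on_exchange_line set_parameters by (blast intro: inj_on_subset)+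
  moreover have "diagonal_line p \<noteq> exchange_line q" if "q \<in> set exchange_parameters" for p q
  proof -
    obtain \<epsilon> i \<delta> j k where "p = (\<epsilon>, i)" "q = (\<delta>, j, k)"
      by (metis prod.exhaust)
    moreover from this have "\<delta> \<in> {1, -1}"
      using that set_parameters(2) by blast
    ultimately show ?thesis
      using diagonal_line_neq_exchange_line by metis
  qed
  ultimately show ?thesis
    unfolding lines_list_eq by (auto simp: distinct_map)
qed

lemma lines_list_subset: "\<forall>X \<in> set (lines_list \<tau>). X \<subseteq> quartic_surface"
proof -
  have "diagonal_line p \<subseteq> quartic_surface" if "p \<in> set diagonal_parameters" for p
    using subsetD[OF set_parameters(1) that] diagonal_line_subset by (cases p) blast
  moreover have "exchange_line p \<subseteq> quartic_surface" if "p \<in> set exchange_parameters" for p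
    using subsetD[OF set_parameters(2) that] exchange_line_subset by (cases p) blast
  ultimately show ?thesis
    unfolding lines_list_eq set_append set_map by blast
qed

lemma length_lines_list: "length (lines_list \<tau>) = 24"
  by (simp add: lines_list_def)

end

theorem proposition3p3:
  fixes \<tau> :: "'k::field_char_0"
  assumes "\<tau> ^ 2 = -3"
    and "rat_adjoin \<tau> = (UNIV :: 'k set)"
  shows "(\<forall>i\<in>{1..24}. \<forall>j\<in>{1..24}. i \<noteq> j \<longrightarrow> L \<tau> i \<noteq> L \<tau> j)
    \<and> (\<forall>j\<in>{1..24}. L \<tau> j \<subseteq> quartic_surface)"
proof -
  interpret sqrt_minus_three \<tau>
    using assms(1) by unfold_locales
  have "L \<tau> i \<noteq> L \<tau> j" if "i \<in> {1..24}" "j \<in> {1..24}" "i \<noteq> j" for i j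
    using that distinct_lines_list length_lines_list
    by (auto simp: L_def nth_eq_iff_index_eq)
  moreover have "L \<tau> j \<subseteq> quartic_surface" if "j \<in> {1..24}" for j
  proof -
    have "L \<tau> j \<in> set (lines_list \<tau>)"
      using that unfolding L_def by (intro nth_mem) (auto simp: length_lines_list)
    then show ?thesis
      using lines_list_subset by blast
  qed
  ultimately show ?thesis
    by blast
qed

end
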